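(* Let $n>0$ and $k\ge 1$ be integers. Then $$(-1)^{k-1}\sum_{j=0}^{k-1}(-1)^j\Big(p\big(n-j(3j+1)/2\big)-p\big(n-j(3j+5)/2-1\big)\Big)=|A_{k-1}^{(2)}(n)|-|A_{-k}^{(1)}(n)|.$$ Furthermore, $|A_{k}^{(1)}(n)|=|A_{k-1}^{(2)}(n)|\ge |A_{-k}^{(1)}(n)|$.
   Context: A partition of a positive integer $m$ is a non-increasing finite sequence of positive integers with sum $m$. $P(m)$ denotes the set of all partitions of $m$, where $P(0)$ consists of the empty partition only and $P(m)=\emptyset$ for $m<0$. $p(m)=|P(m)|$ is the number of partitions of $m$, so $p(0)=1$ and $p(m)=0$ for $m<0$. For a finite set $A$, $|A|$ denotes its number of elements. The (Dyson) rank of a partition $\lambda$, denoted $\mathrm{rank}(\lambda)$, is the largest part of $\lambda$ minus the number of parts of $\lambda$; the empty partition has rank $0$. For a nonnegative integer $n$ and any integer $j$ (possibly negative), define $$A_{j}^{(1)}(n):=\{\lambda \in P(n-j(3j+1)/2): \mathrm{rank}(\lambda)\leq 3j\},$$ $$A_{j}^{(2)}(n):=\{\lambda \in P(n-j(3j+1)/2): \mathrm{rank}(\lambda)> 3j\}.$$ *)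

theory Defs
  imports Main
begin

text \<open>The argument is an integer, so that there is no partition of a negative number,
  while the empty list is the unique partition of \<open>0\<close>.\<close>

definition partitions :: "int \<Rightarrow> nat list set" where
  "partitions m =
     {xs. sorted_wrt (\<ge>) xs \<and> (\<forall>x\<in>set xs. 0 < x) \<and> int (sum_list xs) = m}"

definition num_partitions :: "int \<Rightarrow> nat" where
  "num_partitions m = card (partitions m)"

definition dyson_rank :: "nat list \<Rightarrow> int" where
  "dyson_rank xs = (if xs = [] then 0 else int (Max (set xs)) - int (length xs))"

text \<open>The product \<open>j * (3 * j + 1)\<close> is always even, so the integer division is exact.\<close>

definition A1 :: "int \<Rightarrow> nat \<Rightarrow> nat list set" where
  "A1 j n = {xs \<in> partitions (int n - (j * (3 * j + 1)) div 2). dyson_rank xs \<le> 3 * j}"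

definition A2 :: "int \<Rightarrow> nat \<Rightarrow> nat list set" where
  "A2 j n = {xs \<in> partitions (int n - (j * (3 * j + 1)) div 2). dyson_rank xs > 3 * j}"

text \<open>The cardinality of an infinite set is \<open>0\<close> by convention; the following shows that
  this plays no role here.\<close>

lemma finite_partitions: "finite (partitions m)"
proof (rule finite_subset)
  show "partitions m \<subseteq> {xs. set xs \<subseteq> {..nat m} \<and> length xs \<le> nat m}"
  proof (intro subsetI CollectI conjI)
    fix xs x assume "xs \<in> partitions m" "x \<in> set xs"
    then show "x \<in> {..nat m}"
      using member_le_sum_list[of x xs] by (auto simp: partitions_def)
  next
    fix xs assume "xs \<in> partitions m"
    moreover have "(\<forall>x\<in>set xs. 0 < x) \<Longrightarrow> length xs \<le> sum_list xs" for xs :: "nat list"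
      by (induction xs) (auto simp: Suc_le_eq)
    ultimately show "length xs \<le> nat m"
      by (auto simp: partitions_def)
  qed
  show "finite {xs. set xs \<subseteq> {..nat m} \<and> length xs \<le> nat m}"
    by (rule finite_lists_length_le) simp
qed

end

theory Submission
  imports Defs
begin

text \<open>Dyson's adjoint replaces a partition \<open>\<lambda>\<close> with \<open>t\<close> parts and rank at most \<open>r\<close> by
  \<open>(t + r - 1, \<lambda>\<^sub>1 - 1, \<dots>, \<lambda>\<^sub>t - 1)\<close>, zeros being dropped; this is a bijection onto the
  partitions of \<open>|\<lambda>| + r - 1\<close> of rank at least \<open>r - 2\<close>. At \<open>r = 3 j\<close> it identifies \<open>A1 j n\<close>
  with \<open>A2 (j - 1) n\<close>, and since \<open>j (3 j + 5) / 2 + 1\<close> is the pentagonal number of index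
  \<open>- (j + 1)\<close>, the alternating sum telescopes. Applied twice, the adjoint shows that the numbers
  of partitions of \<open>m\<close> of rank at least \<open>s\<close> and of rank at most \<open>- s\<close> satisfy the same recursion in
  \<open>(m, s)\<close>, hence agree; so partitions need not be conjugated. The inequality then follows by
  enlarging the largest part by \<open>2 k - 1\<close>.\<close>

definition largest :: "nat list \<Rightarrow> nat" where
  "largest xs = (if xs = [] then 0 else hd xs)"

lemma largest_simps [simp]: "largest [] = 0" "largest (x # xs) = x"
  by (simp_all add: largest_def)

text \<open>Setting \<open>largest [] = 0\<close> matches the convention that the empty partition
  has rank 0, so one formula covers every partition.\<close>

lemma dyson_rank_eq:
  assumes "xs \<in> partitions m"
  shows "dyson_rank xs = int (largest xs) - int (length xs)"
proof (cases xs)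
  case (Cons y ys)
  then have "Max (set xs) = y"
    using assms by (intro Max_eqI) (auto simp: partitions_def)
  then show ?thesis
    using Cons by (simp add: dyson_rank_def)
qed (simp add: dyson_rank_def)

definition rank_le :: "int \<Rightarrow> int \<Rightarrow> nat list set" where
  "rank_le r m = {xs \<in> partitions m. dyson_rank xs \<le> r}"

definition rank_gt :: "int \<Rightarrow> int \<Rightarrow> nat list set" where
  "rank_gt r m = {xs \<in> partitions m. dyson_rank xs > r}"

lemma num_partitions_split: "num_partitions m = card (rank_le r m) + card (rank_gt r m)"
proof -
  have "partitions m = rank_le r m \<union> rank_gt r m"
    by (auto simp: rank_le_def rank_gt_def)
  moreover have "rank_le r m \<inter> rank_gt r m = {}"
    by (auto simp: rank_le_def rank_gt_def)
  moreover have "finite (rank_le r m)" "finite (rank_gt r m)"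
    using finite_partitions[of m] by (auto simp: rank_le_def rank_gt_def)
  ultimately show ?thesis
    by (simp add: num_partitions_def card_Un_disjoint)
qed

section \<open>Dyson's adjoint and its inverse\<close>

definition adjoint :: "int \<Rightarrow> nat list \<Rightarrow> nat list" where
  "adjoint r xs = filter ((<) 0) (nat (int (length xs) + r - 1) # map (\<lambda>x. x - 1) xs)"

text \<open>The largest part of an adjoint encodes the number of parts of the original,
  \<open>largest ys - r + 1\<close>. The appended ones are the parts that became zero and were
  dropped.\<close>

definition coadjoint :: "int \<Rightarrow> nat list \<Rightarrow> nat list" where
  "coadjoint r ys =
     map Suc (tl ys) @ replicate (nat (int (largest ys) - r + 1) - length (tl ys)) 1"

text \<open>Zeros can only stand at the end, so their number suffices to restore them.\<close>

lemma filter_pos_append_zeros: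
  assumes "sorted_wrt (\<ge>) (xs :: nat list)"
  shows "filter ((<) 0) xs @ replicate (length xs - length (filter ((<) 0) xs)) 0 = xs"
  using assms
proof (induction xs)
  case (Cons x xs)
  show ?case
  proof (cases "x = 0")
    case True
    then have "\<forall>y\<in>set xs. y = 0"
      using Cons.prems by auto
    then have "filter ((<) 0) xs = []" "replicate (length xs) 0 = xs"
      by (auto simp: filter_empty_conv intro: replicate_eqI[symmetric])
    then show ?thesis
      using True by simp
  next
    case False
    then show ?thesis
      using Cons by simp
  qed
qed simp

lemma sum_list_filter_pos: "sum_list (filter ((<) 0) xs) = sum_list (xs :: nat list)"
  by (induction xs) auto

lemma sum_list_map_pred:
  "\<forall>x\<in>set xs. 0 < x \<Longrightarrow> sum_list (map (\<lambda>x. x - 1) xs) + length xs = sum_list (xs :: nat list)"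
  by (induction xs) auto

lemma coadjoint_adjoint:
  assumes xs: "xs \<in> rank_le r m" and edge: "m \<noteq> 0 \<or> r \<noteq> 0"
  shows "coadjoint r (adjoint r xs) = xs" "adjoint r xs \<in> rank_gt (r - 3) (m + r - 1)"
proof -
  have p: "xs \<in> partitions m" and rk: "int (largest xs) \<le> int (length xs) + r"
    using xs dyson_rank_eq[of xs m] by (auto simp: rank_le_def)
  then have sorted: "sorted_wrt (\<ge>) xs" and pos: "\<forall>x\<in>set xs. 0 < x"
    and sum: "int (sum_list xs) = m"
    by (auto simp: partitions_def)
  define s where "s = nat (int (length xs) + r - 1)"
  define zs where "zs = map (\<lambda>x. x - 1) xs"
  \<comment> \<open>Here \<open>nat\<close> does not truncate: a nonempty \<open>xs\<close> has
    largest part at least 1, and for \<open>xs = []\<close> the sum is 0, so \<open>edge\<close> and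
    \<open>rk\<close> force \<open>r > 0\<close>.\<close>
  have s: "int s = int (length xs) + r - 1"
    using rk pos edge sum by (cases xs) (auto simp: s_def)
  \<comment> \<open>The rank bound says exactly that the new head \<open>s\<close> is at least
    \<open>largest xs - 1\<close>.\<close>
  have sorted_zs: "sorted_wrt (\<ge>) (s # zs)"
  proof -
    have "x \<le> largest xs" if "x \<in> set xs" for x
      using sorted that by (cases xs) auto
    then have "x - 1 \<le> s" if "x \<in> set xs" for x
      using that rk s by force
    then show ?thesis
      using sorted by (auto simp: zs_def sorted_wrt_map elim: sorted_wrt_mono_rel[rotated])
  qed
  have adj: "adjoint r xs = filter ((<) 0) (s # zs)"
    by (simp add: adjoint_def s_def zs_def)
  \<comment> \<open>If \<open>s = 0\<close>, then all of \<open>zs\<close> vanishes by sortedness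
    and both sides are empty.\<close>
  have tl_adj: "tl (adjoint r xs) = filter ((<) 0) zs"
    using sorted_zs by (auto simp: adj filter_empty_conv)
  have largest_adj: "largest (adjoint r xs) = s"
    using sorted_zs by (cases "s = 0") (auto simp: adj largest_def filter_empty_conv)
  have "coadjoint r (adjoint r xs) =
      map Suc (filter ((<) 0) zs) @ replicate (length zs - length (filter ((<) 0) zs)) 1"
    by (simp add: coadjoint_def tl_adj largest_adj s zs_def)
  also have "\<dots> = map Suc (filter ((<) 0) zs @ replicate (length zs - length (filter ((<) 0) zs)) 0)"
    by simp
  also have "\<dots> = map Suc zs"
    using filter_pos_append_zeros[of zs] sorted_zs by simp
  also have "\<dots> = xs"
    using pos by (auto simp: zs_def intro!: map_idI)
  finally show "coadjoint r (adjoint r xs) = xs" .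
  have "sum_list (adjoint r xs) = s + sum_list zs"
    by (simp add: adj sum_list_filter_pos)
  then have "int (sum_list (adjoint r xs)) = m + r - 1"
    using sum_list_map_pred[OF pos] s sum by (simp add: zs_def)
  moreover have "sorted_wrt (\<ge>) (adjoint r xs)"
    unfolding adj using sorted_zs by (rule sorted_wrt_filter)
  ultimately have part: "adjoint r xs \<in> partitions (m + r - 1)"
    by (auto simp: partitions_def adj)
  \<comment> \<open>One part more at most, with largest part \<open>s\<close>: the rank is at least
    \<open>s - (length xs + 1) = r - 2\<close>.\<close>
  have "length (adjoint r xs) \<le> Suc (length xs)"
    using length_filter_le[of "(<) 0" "s # zs"] unfolding adj by (simp add: zs_def)
  then have "dyson_rank (adjoint r xs) > r - 3"
    using dyson_rank_eq[OF part] s by (simp add: largest_adj)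
  then show "adjoint r xs \<in> rank_gt (r - 3) (m + r - 1)"
    using part by (simp add: rank_gt_def)
qed

lemma adjoint_coadjoint:
  assumes ys: "ys \<in> rank_gt (r - 3) (m + r - 1)" and edge: "m \<noteq> -1 \<or> r \<noteq> 2"
  shows "adjoint r (coadjoint r ys) = ys" "coadjoint r ys \<in> rank_le r m"
proof -
  have p: "ys \<in> partitions (m + r - 1)" and rk: "int (length ys) < int (largest ys) - r + 3"
    using ys dyson_rank_eq[of ys] by (auto simp: rank_gt_def)
  then have sorted: "sorted_wrt (\<ge>) ys" and pos: "\<forall>y\<in>set ys. 0 < y"
    and sum: "int (sum_list ys) = m + r - 1"
    by (auto simp: partitions_def)
  define t where "t = nat (int (largest ys) - r + 1)"
  \<comment> \<open>Again \<open>nat\<close> does not truncate: for \<open>ys = []\<close> the rank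
    bound gives \<open>r <= 2\<close>, and \<open>edge\<close> excludes
    \<open>r = 2\<close>.\<close>
  have t: "int t = int (largest ys) - r + 1"
    using rk edge sum by (cases ys) (auto simp: t_def)
  have len_tl: "length (tl ys) \<le> t"
    using rk t by (cases ys) auto
  have coadj: "coadjoint r ys = map Suc (tl ys) @ replicate (t - length (tl ys)) 1"
    by (simp add: coadjoint_def t_def)
  have len: "length (coadjoint r ys) = t"
    using len_tl by (simp add: coadj)
  have "map (\<lambda>x. x - 1) (coadjoint r ys) = tl ys @ replicate (t - length (tl ys)) 0"
    by (simp add: coadj comp_def)
  then have "adjoint r (coadjoint r ys) =
      filter ((<) 0) (largest ys # tl ys @ replicate (t - length (tl ys)) 0)"
    by (simp add: adjoint_def len t)
  also have "\<dots> = filter ((<) 0) (largest ys # tl ys)"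
    by (simp add: filter_replicate)
  also have "\<dots> = ys"
    using pos by (cases ys) (auto simp: filter_id_conv)
  finally show "adjoint r (coadjoint r ys) = ys" .
  have "sum_list (map Suc zs) = sum_list zs + length zs" for zs
    by (induction zs) auto
  then have "sum_list (coadjoint r ys) = sum_list (tl ys) + t"
    using len_tl by (simp add: coadj sum_list_replicate)
  moreover have "sum_list ys = largest ys + sum_list (tl ys)"
    by (cases ys) auto
  ultimately have "int (sum_list (coadjoint r ys)) = m"
    using t sum by simp
  moreover have "sorted_wrt (\<ge>) (coadjoint r ys)"
  proof -
    have "sorted_wrt (\<ge>) (replicate i (1 :: nat))" for i
      by (induction i) auto
    then show ?thesis
      unfolding coadj using sorted by (cases ys) (auto simp: sorted_wrt_append sorted_wrt_map)
  qed
  ultimately have part: "coadjoint r ys \<in> partitions m"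
    by (auto simp: partitions_def coadj)
  have "int (largest (coadjoint r ys)) \<le> int t + r"
  proof (cases "t = 0")
    case True
    then have "coadjoint r ys = []"
      using len by simp
    moreover have "0 \<le> r"
      using True t by simp
    ultimately show ?thesis by simp
  next
    case False
    have "largest (coadjoint r ys) \<le> largest ys + 1"
      unfolding coadj using sorted
      by (cases "tl ys"; cases ys) (auto simp: largest_def hd_append)
    then show ?thesis
      using t by simp
  qed
  then show "coadjoint r ys \<in> rank_le r m"
    using part dyson_rank_eq[OF part] len by (simp add: rank_le_def)
qed

text \<open>In both excluded cases one side consists of the empty partition and the other is empty.\<close>

lemma card_rank_le_adjoint:
  assumes "m \<noteq> 0 \<or> r \<noteq> 0" "m \<noteq> -1 \<or> r \<noteq> 2"
  shows "card (rank_le r m) = card (rank_gt (r - 3) (m + r - 1))"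
proof -
  have "bij_betw (adjoint r) (rank_le r m) (rank_gt (r - 3) (m + r - 1))"
    using assms coadjoint_adjoint adjoint_coadjoint
    by (intro bij_betw_byWitness[where f' = "coadjoint r"]) (auto; blast)+
  then show ?thesis
    by (rule bij_betw_same_card)
qed

section \<open>Symmetry and monotonicity of the rank counts\<close>

lemma partitions_neg: "m < 0 \<Longrightarrow> partitions m = {}"
  by (auto simp: partitions_def)

lemma card_rank_symmetric:
  assumes "s > 0"
  shows "card (rank_gt (s - 1) m) = card (rank_le (- s) m)"
  using assms
proof (induction "nat (m + 1)" arbitrary: m s rule: less_induct)
  case less
  \<comment> \<open>Both sides lead to this one size: the adjoint is read backwards with parameter
    \<open>s + 2\<close> and forwards with \<open>- s\<close>.\<close>
  define m' where "m' = m - s - 1"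
  have gt: "card (rank_gt (s - 1) m) = card (rank_le (s + 2) m')"
    using card_rank_le_adjoint[of m' "s + 2"] less.prems by (simp add: m'_def)
  have le: "card (rank_le (- s) m) = card (rank_gt (- s - 3) m')"
    using card_rank_le_adjoint[of m "- s"] less.prems by (simp add: m'_def algebra_simps)
  show ?case
  proof (cases "m' < 0")
    case True
    then show ?thesis
      using gt le by (simp add: rank_le_def rank_gt_def partitions_neg)
  next
    case False
    \<comment> \<open>Passing to complements in \<open>partitions m'\<close> turns the two counts
      into those for \<open>s + 3\<close>.\<close>
    then have "card (rank_gt (s + 3 - 1) m') = card (rank_le (- (s + 3)) m')"
      using less.prems by (intro less.hyps) (auto simp: m'_def)
    then show ?thesis
      using gt le num_partitions_split[of m' "s + 2"] num_partitions_split[of m' "- s - 3"]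
      by (simp add: algebra_simps)
  qed
qed

lemma card_rank_gt_mono:
  assumes "0 \<le> r"
  shows "card (rank_gt r m) \<le> card (rank_gt r (m + int d))"
proof (rule card_inj_on_le)
  let ?f = "\<lambda>xs. (hd xs + d) # tl xs"
  \<comment> \<open>The empty partition has rank 0, so \<open>0 <= r\<close> excludes it and
    \<open>hd xs\<close> is meaningful.\<close>
  have ne: "xs \<noteq> []" if "xs \<in> rank_gt r m" for xs
    using that assms by (auto simp: rank_gt_def dyson_rank_def)
  show "inj_on ?f (rank_gt r m)"
    by (rule inj_onI) (metis add_right_cancel list.inject list.expand ne)
  show "?f ` rank_gt r m \<subseteq> rank_gt r (m + int d)"
  proof
    fix ys assume "ys \<in> ?f ` rank_gt r m"
    then obtain xs where xs: "xs \<in> rank_gt r m" and ys: "ys = ?f xs"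
      by auto
    obtain z zs where z: "xs = z # zs"
      using ne[OF xs] by (cases xs) auto
    have p: "xs \<in> partitions m"
      using xs by (simp add: rank_gt_def)
    then have q: "ys \<in> partitions (m + int d)"
      by (auto simp: ys z partitions_def)
    show "ys \<in> rank_gt r (m + int d)"
      using xs q dyson_rank_eq[OF p] dyson_rank_eq[OF q] by (simp add: rank_gt_def ys z)
  qed
  show "finite (rank_gt r (m + int d))"
    using finite_partitions[of "m + int d"] by (simp add: rank_gt_def)
qed

section \<open>Pentagonal numbers and the telescoping sum\<close>

lemma A1_eq_rank_le: "A1 j n = rank_le (3 * j) (int n - (j * (3 * j + 1)) div 2)"
  by (simp add: A1_def rank_le_def)

lemma A2_eq_rank_gt: "A2 j n = rank_gt (3 * j) (int n - (j * (3 * j + 1)) div 2)"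
  by (simp add: A2_def rank_gt_def)

lemma card_A1_eq_card_A2:
  assumes "n > 0"
  shows "card (A1 j n) = card (A2 (j - 1) n)"
proof -
  \<comment> \<open>Consecutive pentagonal numbers differ by \<open>r - 1\<close> for
    \<open>r = 3 * j\<close>, the change of size under the adjoint.\<close>
  have "j * (3 * j + 1) = (j - 1) * (3 * (j - 1) + 1) + (3 * j - 1) * 2"
    by (simp add: algebra_simps)
  then have "(j * (3 * j + 1)) div 2 = ((j - 1) * (3 * (j - 1) + 1)) div 2 + (3 * j - 1)"
    by simp
  \<comment> \<open>This rules out the exceptional case \<open>r = 2\<close>; in the case
    \<open>r = 0\<close> the size is \<open>n > 0\<close>.\<close>
  moreover have "3 * j \<noteq> 2"
    by presburger
  ultimately show ?thesis
    using assms card_rank_le_adjoint[of "int n - (j * (3 * j + 1)) div 2" "3 * j"]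
    by (cases "j = 0") (simp_all add: A1_eq_rank_le A2_eq_rank_gt algebra_simps)
qed

lemma card_A1_neg_le_card_A2:
  assumes "k \<ge> 1"
  shows "card (A1 (- int k) n) \<le> card (A2 (int k - 1) n)"
proof -
  define m where "m = int n - (- int k * (3 * - int k + 1)) div 2"
  \<comment> \<open>The difference \<open>2 * k - 1\<close> of the two pentagonal numbers is the
    amount added to the largest part.\<close>
  have "- int k * (3 * - int k + 1) = (int k - 1) * (3 * (int k - 1) + 1) + (2 * int k - 1) * 2"
    by (simp add: algebra_simps)
  then have "(- int k * (3 * - int k + 1)) div 2
      = ((int k - 1) * (3 * (int k - 1) + 1)) div 2 + (2 * int k - 1)"
    by simp
  then have m: "int n - ((int k - 1) * (3 * (int k - 1) + 1)) div 2 = m + int (2 * k - 1)"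
    using assms by (simp add: m_def of_nat_diff)
  have "card (A1 (- int k) n) = card (rank_gt (3 * int k - 1) m)"
    using card_rank_symmetric[of "3 * int k" m] assms by (simp add: A1_eq_rank_le m_def)
  also have "\<dots> \<le> card (rank_gt (3 * int k - 1) (m + int (2 * k - 1)))"
    using assms by (intro card_rank_gt_mono) simp
  \<comment> \<open>Only rank above \<open>3 * k - 3\<close> is required here.\<close>
  also have "\<dots> \<le> card (A2 (int k - 1) n)"
    unfolding A2_eq_rank_gt m using finite_partitions[of "m + int (2 * k - 1)"]
    by (intro card_mono) (auto simp: rank_gt_def)
  finally show ?thesis .
qed

lemma num_partitions_pentagonal:
  "num_partitions (int n - (j * (3 * j + 1)) div 2) = card (A1 j n) + card (A2 j n)"
  unfolding A1_eq_rank_le A2_eq_rank_gt by (rule num_partitions_split)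

lemma num_partitions_pentagonal_neg:
  "num_partitions (int n - (j * (3 * j + 5)) div 2 - 1) = card (A1 (- j - 1) n) + card (A2 (- j - 1) n)"
proof -
  have "(- j - 1) * (3 * (- j - 1) + 1) = j * (3 * j + 5) + 1 * 2"
    by (simp add: algebra_simps)
  then have "((- j - 1) * (3 * (- j - 1) + 1)) div 2 = (j * (3 * j + 5)) div 2 + 1"
    by simp
  then show ?thesis
    using num_partitions_pentagonal[of n "- j - 1"] by (simp add: algebra_simps)
qed

lemma truncated_pentagonal_sum:
  assumes "n > 0"
  shows "(-1) ^ k *
           (\<Sum>j = 0..k. (-1) ^ j *
              (int (num_partitions (int n - (int j * (3 * int j + 1)) div 2))
               - int (num_partitions (int n - (int j * (3 * int j + 5)) div 2 - 1))))
         = int (card (A2 (int k) n)) - int (card (A1 (- int k - 1) n))"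
  unfolding num_partitions_pentagonal num_partitions_pentagonal_neg
proof (induction k)
  case 0
  then show ?case
    using card_A1_eq_card_A2[OF assms, of 0] by simp
next
  case (Suc k)
  have sq: "(-1) ^ k * ((-1) ^ k :: int) = 1"
    by (simp flip: power_add)
  \<comment> \<open>The previous value enters with the opposite sign, and these two equalities
    cancel it against half of the new summand.\<close>
  have "card (A1 (int (Suc k)) n) = card (A2 (int k) n)"
    using card_A1_eq_card_A2[OF assms, of "int (Suc k)"] by simp
  moreover have "card (A1 (- int k - 1) n) = card (A2 (- int (Suc k) - 1) n)"
    using card_A1_eq_card_A2[OF assms, of "- int k - 1"] by (simp add: algebra_simps)
  ultimately show ?case
    using Suc.IH sq by (simp add: algebra_simps)
qed

theorem theorem2:
  fixes n k :: nat
  assumes "n > 0" and "k \<ge> 1"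
  shows "(-1) ^ (k - 1) *
           (\<Sum>j = 0..k - 1. (-1) ^ j *
              (int (num_partitions (int n - (int j * (3 * int j + 1)) div 2))
               - int (num_partitions (int n - (int j * (3 * int j + 5)) div 2 - 1))))
         = int (card (A2 (int k - 1) n)) - int (card (A1 (- int k) n))
       \<and> card (A1 (int k) n) = card (A2 (int k - 1) n)
       \<and> card (A2 (int k - 1) n) \<ge> card (A1 (- int k) n)"
  using truncated_pentagonal_sum[OF assms(1), of "k - 1"] card_A1_eq_card_A2[OF assms(1), of "int k"]
    card_A1_neg_le_card_A2[OF assms(2), of n] assms(2)
  by (simp add: of_nat_diff)

end
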